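(* Let $\psi(x,t)\ge0$ satisfy the linear problem $$\frac{\partial \psi}{\partial t} = D\frac{\partial^2\psi}{\partial x^2}+f'(0)\psi \quad\text{in } 0<x<L(t),\qquad \psi(0,t)=\psi(L(t),t)=0,$$ and assume that the following conditions hold: (i) $L(t)$ and $\dot L(t)L(t)$ are bounded above on $t\ge0$; (ii) $\displaystyle\int_0^t\left(\frac{1}{L(\zeta)^2}-\frac{1}{L_{crit}^2}\right)d\zeta$ is bounded above on $t\ge0$; (iii) $\displaystyle\int_0^\infty L(t)[\ddot L(t)]^-\,dt<\infty$. Then for $\psi(x,0)\ge0$ and not identically zero, $\psi(x,t)$ does not converge to zero as $t\to\infty$. In particular, $$\liminf_{t\to\infty}\left(\frac{2}{L(t)}\int_0^{L(t)}\psi(x,t)\sin\left(\frac{\pi x}{L(t)}\right)dx\right)>0.$$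
   Context: Here $D>0$ and $f'(0)>0$ are constants (the reaction term is the linear function $f(\psi)=f'(0)\psi$), and $L_{crit}=\pi\sqrt{D/f'(0)}$. The function $L(t)$ is a prescribed twice continuously differentiable function of $t\ge0$ with $L(t)>0$ for all $t\ge0$; dots denote derivatives with respect to $t$. Solutions $\psi$ are non-negative, and the problem is posed for $t\ge0$. For any function $F(t)$, $[F(t)]^+\ge0$ and $[F(t)]^-\ge0$ denote its positive and negative parts, so that $F(t)\equiv[F(t)]^+-[F(t)]^-$. *)

theory Defs
  imports "HOL-Analysis.Analysis"
begin

definition L_crit :: "real \<Rightarrow> real \<Rightarrow> real" where
  "L_crit D r = pi * sqrt (D / r)"

text \<open>The negative part is itself nonnegative: \<open>y = max y 0 - neg_part y\<close>.\<close>

definition neg_part :: "real \<Rightarrow> real" where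
  "neg_part y = max (- y) 0"

definition moving_domain :: "(real \<Rightarrow> real) \<Rightarrow> (real \<times> real) set" where
  "moving_domain L = {(x, t). 0 < t \<and> 0 < x \<and> x < L t}"

definition closed_moving_domain :: "(real \<Rightarrow> real) \<Rightarrow> (real \<times> real) set" where
  "closed_moving_domain L = {(x, t). 0 \<le> t \<and> 0 \<le> x \<and> x \<le> L t}"

text \<open>
  Classical solutions of \<open>\<psi>\<^sub>t = D \<psi>\<^sub>x\<^sub>x + r \<psi>\<close> with zero Dirichlet data, where \<open>r\<close> stands
  for \<open>f'(0)\<close>: \<open>\<psi>\<close> is continuous up to the parabolic boundary, so that the initial data
  \<open>\<psi>(x,0)\<close> are attained, but its derivatives need only exist and be continuous in the
  interior.  The values of \<open>\<psi>\<close> outside the closed domain are irrelevant.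
\<close>

definition classical_solution ::
  "real \<Rightarrow> real \<Rightarrow> (real \<Rightarrow> real) \<Rightarrow> (real \<Rightarrow> real \<Rightarrow> real) \<Rightarrow> bool" where
  "classical_solution D r L \<psi> \<longleftrightarrow>
     continuous_on (closed_moving_domain L) (\<lambda>(x, t). \<psi> x t) \<and>
     (\<forall>t\<ge>0. \<psi> 0 t = 0 \<and> \<psi> (L t) t = 0) \<and>
     (\<exists>\<psi>\<^sub>t \<psi>\<^sub>x \<psi>\<^sub>x\<^sub>x.
        continuous_on (moving_domain L) (\<lambda>(x, t). \<psi>\<^sub>t x t) \<and>
        continuous_on (moving_domain L) (\<lambda>(x, t). \<psi>\<^sub>x x t) \<and>
        continuous_on (moving_domain L) (\<lambda>(x, t). \<psi>\<^sub>x\<^sub>x x t) \<and>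
        (\<forall>(x, t) \<in> moving_domain L.
           ((\<lambda>s. \<psi> x s) has_real_derivative \<psi>\<^sub>t x t) (at t) \<and>
           ((\<lambda>y. \<psi> y t) has_real_derivative \<psi>\<^sub>x x t) (at x) \<and>
           ((\<lambda>y. \<psi>\<^sub>x y t) has_real_derivative \<psi>\<^sub>x\<^sub>x x t) (at x) \<and>
           \<psi>\<^sub>t x t = D * \<psi>\<^sub>x\<^sub>x x t + r * \<psi> x t))"

text \<open>
  Uniform convergence to zero over the moving interval: \<open>x = \<xi> L(t)\<close> runs through
  \<open>[0, L(t)]\<close> as \<open>\<xi>\<close> runs through the fixed interval \<open>[0,1]\<close>.
\<close>

definition converges_to_zero :: "(real \<Rightarrow> real) \<Rightarrow> (real \<Rightarrow> real \<Rightarrow> real) \<Rightarrow> bool" where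
  "converges_to_zero L \<psi> \<longleftrightarrow>
     uniform_limit {0..1} (\<lambda>t \<xi>. \<psi> (\<xi> * L t) t) (\<lambda>_. 0) at_top"

end

theory Submission
  imports Defs
begin

text \<open>
  In the straightened coordinate \<open>\<xi> = x / L(t)\<close> the equation for \<open>u(\<xi>,t) = \<psi>(\<xi> L(t), t)\<close> lives on
  the fixed interval \<open>[0,1]\<close>.  The idea is to test it against a positive subsolution of the
  adjoint (backward) problem. Write \<open>E\<close> for the integral over \<open>[0,t]\<close> of the rate
  \<open>D \<pi>\<^sup>2 / L\<^sup>2 - r + L [L'']\<^sup>- / (4D)\<close>. The weight \<open>exp (\<xi>\<^sup>2 L L' / (4D) + E) L\<^bsup>1/2\<^esup>\<close>, multiplied
  by \<open>sin (\<pi> \<xi>)\<close>, is such a subsolution (the factor \<open>L\<^bsup>1/2\<^esup>\<close> includes the Jacobian \<open>L\<close> of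
  \<open>x = \<xi> L\<close>), so the weighted mean of \<open>u\<close> does not decrease in time.  It is positive at time \<open>0\<close>,
  and the three conditions bound the weight from above, uniformly in \<open>t\<close>.  Hence the plain sine mean of
  \<open>u\<close> stays above a positive constant, and this also excludes uniform convergence to zero.

  The derivatives of \<open>\<psi>\<close> are controlled only in the interior, so neither the integration by
  parts nor the differentiation under the integral is available up to the ends of \<open>[0,1]\<close>.
  Therefore the sine is replaced by \<open>cos (\<pi> k (\<xi> - 1/2))\<close> with \<open>k > 1\<close>, restricted to the interval
  around \<open>1/2\<close> on which it is nonnegative; for \<open>k = 1\<close> this is the sine again.
  The integration by parts then leaves boundary terms, but they have the good sign because \<open>u \<ge> 0\<close>
  (\<open>flux_ends\<close>), and the means are monotone in time for every \<open>k > 1\<close> (\<open>mean_mono\<close>).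
  The price is a larger decay rate \<open>D (\<pi> k / L)\<^sup>2\<close>.  As the truncated profiles grow when \<open>k\<close>
  decreases (\<open>profile_mean_antimono\<close>), \<open>k\<close> may be chosen after \<open>t\<close>, so close to \<open>1\<close> that the
  extra decay up to time \<open>t\<close> costs at most a factor \<open>e\<close> (\<open>projection_lower_bound\<close>).
\<close>

section \<open>Truncated cosine profiles\<close>

text \<open>The test profile; it is meant to be used on \<open>core k\<close>, where it is nonnegative.\<close>

definition profile :: "real \<Rightarrow> real \<Rightarrow> real" where
  "profile k \<xi> = cos (pi * k * (\<xi> - 1/2))"

text \<open>The interval between the two zeros of \<open>profile k\<close> nearest to \<open>1/2\<close>; \<open>core 1\<close> is \<open>[0,1]\<close>.\<close>

abbreviation core :: "real \<Rightarrow> real set" where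
  "core k \<equiv> {1/2 - 1/(2*k)..1/2 + 1/(2*k)}"

lemma profile_1: "profile 1 \<xi> = sin (pi * \<xi>)"
proof -
  have "sin (pi * \<xi>) = cos (pi / 2 - pi * \<xi>)"
    by (simp add: sin_cos_eq)
  also have "\<dots> = cos (pi * \<xi> - pi / 2)"
    by (metis cos_minus minus_diff_eq)
  finally show ?thesis
    by (simp add: profile_def algebra_simps)
qed

lemma core_mono:
  assumes "0 < k" "k \<le> k'"
  shows "core k' \<subseteq> core k"
proof -
  have "1/(2*k') \<le> 1/(2*k)"
    using assms by (simp add: field_simps)
  then show ?thesis by auto
qed

lemma core_subset_open:
  assumes "1 < k"
  shows "core k \<subseteq> {0<..<1}"
proof -
  have "1/(2*k) < 1/2"
    using assms by (simp add: field_simps)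
  then show ?thesis by (auto simp del: divide_less_eq_1)
qed

lemma core_abs_le:
  assumes "0 < k" "\<xi> \<in> core k"
  shows "k * \<bar>\<xi> - 1/2\<bar> \<le> 1/2"
proof -
  have "\<bar>\<xi> - 1/2\<bar> \<le> 1/(2*k)"
    using assms(2) unfolding atLeastAtMost_iff by (intro abs_leI) linarith+
  then have "k * \<bar>\<xi> - 1/2\<bar> \<le> k * (1/(2*k))"
    using assms(1) by (intro mult_left_mono) auto
  then show ?thesis using assms(1) by simp
qed

lemma profile_antimono:
  assumes "0 < k" "k \<le> k'" "\<xi> \<in> core k'"
  shows "profile k' \<xi> \<le> profile k \<xi>"
proof -
  have "pi * (k' * \<bar>\<xi> - 1/2\<bar>) \<le> pi * (1/2)"
    using core_abs_le[of k' \<xi>] assms by (intro mult_left_mono) auto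
  moreover have "pi * k * \<bar>\<xi> - 1/2\<bar> \<le> pi * k' * \<bar>\<xi> - 1/2\<bar>"
    using assms by (intro mult_right_mono) auto
  ultimately have "cos (pi * k' * \<bar>\<xi> - 1/2\<bar>) \<le> cos (pi * k * \<bar>\<xi> - 1/2\<bar>)"
    using assms by (intro cos_monotone_0_pi_le) (auto simp: mult.assoc)
  moreover have "cos (pi * c * \<bar>\<xi> - 1/2\<bar>) = profile c \<xi>" for c
    unfolding profile_def by (cases "\<xi> - 1/2 \<ge> 0") (auto simp: abs_if, metis cos_minus mult_minus_right minus_diff_eq)
  ultimately show ?thesis by simp
qed

lemma profile_nonneg:
  assumes "0 < k" "\<xi> \<in> core k"
  shows "0 \<le> profile k \<xi>"
proof -
  have "pi * (k * \<bar>\<xi> - 1/2\<bar>) \<le> pi * (1/2)"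
    using core_abs_le[OF assms] by (intro mult_left_mono) auto
  moreover have "\<bar>pi * k * (\<xi> - 1/2)\<bar> = pi * (k * \<bar>\<xi> - 1/2\<bar>)"
    using assms(1) by (simp add: abs_mult)
  ultimately show ?thesis
    unfolding profile_def by (intro cos_ge_zero) linarith+
qed

lemma profile_ends:
  assumes "0 < k"
  shows "profile k (1/2 - 1/(2*k)) = 0" "profile k (1/2 + 1/(2*k)) = 0"
    "sin (pi * k * ((1/2 - 1/(2*k)) - 1/2)) = -1" "sin (pi * k * ((1/2 + 1/(2*k)) - 1/2)) = 1"
  using assms by (simp_all add: profile_def)

lemma continuous_on_profile [continuous_intros]:
  fixes f :: "'a::t2_space \<Rightarrow> real"
  shows "continuous_on S f \<Longrightarrow> continuous_on S (\<lambda>p. profile k (f p))"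
  unfolding profile_def by (intro continuous_intros)

text \<open>
  For \<open>k = 1\<close> this compares a truncated mean with the full sine mean; for \<open>k'\<close> fixed it bounds
  the truncated means from below uniformly in \<open>k \<le> k'\<close>.
\<close>

lemma profile_mean_antimono:
  fixes h :: "real \<Rightarrow> real"
  assumes "1 \<le> k" "k \<le> k'" and h: "continuous_on {0..1} h" "\<And>\<xi>. \<xi> \<in> {0..1} \<Longrightarrow> 0 \<le> h \<xi>"
  shows "integral (core k') (\<lambda>\<xi>. h \<xi> * profile k' \<xi>) \<le> integral (core k) (\<lambda>\<xi>. h \<xi> * profile k \<xi>)"
proof -
  have sub: "core k' \<subseteq> core k" and sub1: "core k \<subseteq> {0..1}"
    using core_mono[of k k'] core_mono[of 1 k] assms by auto
  have int: "(\<lambda>\<xi>. h \<xi> * profile j \<xi>) integrable_on core i" if "core i \<subseteq> {0..1}" for i j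
    by (intro integrable_continuous_real continuous_intros continuous_on_subset[OF h(1) that])
  have "integral (core k') (\<lambda>\<xi>. h \<xi> * profile k' \<xi>) \<le> integral (core k') (\<lambda>\<xi>. h \<xi> * profile k \<xi>)"
  proof (rule integral_le[OF int int])
    show "core k' \<subseteq> {0..1}" "core k' \<subseteq> {0..1}"
      using sub sub1 by blast+
    show "h \<xi> * profile k' \<xi> \<le> h \<xi> * profile k \<xi>" if "\<xi> \<in> core k'" for \<xi>
    proof (rule mult_left_mono)
      show "profile k' \<xi> \<le> profile k \<xi>"
        using that assms(1,2) by (intro profile_antimono) auto
      show "0 \<le> h \<xi>"
        using that sub sub1 by (intro h) blast
    qed
  qed
  also have "\<dots> \<le> integral (core k) (\<lambda>\<xi>. h \<xi> * profile k \<xi>)"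
  proof (rule integral_subset_le[OF sub int int])
    show "core k' \<subseteq> {0..1}" "core k \<subseteq> {0..1}"
      using sub sub1 by blast+
    show "\<forall>\<xi>\<in>core k. 0 \<le> h \<xi> * profile k \<xi>"
    proof
      fix \<xi> assume \<xi>: "\<xi> \<in> core k"
      show "0 \<le> h \<xi> * profile k \<xi>"
        using h(2)[of \<xi>] profile_nonneg[of k \<xi>] \<xi> sub1 assms(1) by (intro mult_nonneg_nonneg) auto
    qed
  qed
  finally show ?thesis .
qed

lemma continuous_on_pair_compose:
  assumes "continuous_on (A \<times> B) (\<lambda>(x, y). h x y)" "continuous_on S f" "continuous_on S g"
    and "\<And>p. p \<in> S \<Longrightarrow> f p \<in> A" "\<And>p. p \<in> S \<Longrightarrow> g p \<in> B"
  shows "continuous_on S (\<lambda>p. h (f p) (g p))"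
  using continuous_on_compose2[OF assms(1), of S "\<lambda>p. (f p, g p)"] assms(2-)
  by (auto intro!: continuous_intros)

section \<open>The problem on a fixed interval\<close>

text \<open>
  The problem for \<open>u(\<xi>,t) = \<psi>(\<xi> L(t), t)\<close>.  The subscripts \<open>t\<close> and \<open>y\<close> stand for the derivatives
  in time and in \<open>\<xi>\<close>.  They are required in the interior only, and of them only \<open>u\<^sub>t\<close> is required
  to be continuous.  The boundary values of \<open>u\<close> play no role here.
\<close>

locale straightened_problem =
  fixes D r :: real and L L' L'' :: "real \<Rightarrow> real"
    and u u\<^sub>t u\<^sub>y u\<^sub>y\<^sub>y :: "real \<Rightarrow> real \<Rightarrow> real"
  assumes D_pos: "D > 0"
    and L_pos: "\<And>t. t \<ge> 0 \<Longrightarrow> L t > 0"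
    and L_deriv: "\<And>t. t \<ge> 0 \<Longrightarrow> (L has_real_derivative L' t) (at t within {0..})"
    and L'_deriv: "\<And>t. t \<ge> 0 \<Longrightarrow> (L' has_real_derivative L'' t) (at t within {0..})"
    and L''_cont: "continuous_on {0..} L''"
    and u_cont: "continuous_on ({0..1} \<times> {0..}) (\<lambda>(\<xi>, t). u \<xi> t)"
    and u_nonneg: "\<And>\<xi> t. \<xi> \<in> {0..1} \<Longrightarrow> t \<ge> 0 \<Longrightarrow> u \<xi> t \<ge> 0"
    and ut_cont: "continuous_on ({0<..<1} \<times> {0<..}) (\<lambda>(\<xi>, t). u\<^sub>t \<xi> t)"
    and ut_deriv: "\<And>\<xi> t. \<xi> \<in> {0<..<1} \<Longrightarrow> t > 0 \<Longrightarrow> ((\<lambda>s. u \<xi> s) has_real_derivative u\<^sub>t \<xi> t) (at t)"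
    and uy_deriv: "\<And>\<xi> t. \<xi> \<in> {0<..<1} \<Longrightarrow> t > 0 \<Longrightarrow> ((\<lambda>y. u y t) has_real_derivative u\<^sub>y \<xi> t) (at \<xi>)"
    and uyy_deriv: "\<And>\<xi> t. \<xi> \<in> {0<..<1} \<Longrightarrow> t > 0 \<Longrightarrow> ((\<lambda>y. u\<^sub>y y t) has_real_derivative u\<^sub>y\<^sub>y \<xi> t) (at \<xi>)"
    and pde: "\<And>\<xi> t. \<xi> \<in> {0<..<1} \<Longrightarrow> t > 0 \<Longrightarrow>
      u\<^sub>t \<xi> t = D / (L t)\<^sup>2 * u\<^sub>y\<^sub>y \<xi> t + \<xi> * L' t / L t * u\<^sub>y \<xi> t + r * u \<xi> t"
begin

lemma L_cont: "continuous_on {0..} L" and L'_cont: "continuous_on {0..} L'"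
  using L_deriv L'_deriv by (auto intro!: DERIV_continuous_on)

lemma L_deriv_at: "t > 0 \<Longrightarrow> (L has_real_derivative L' t) (at t)"
  and L'_deriv_at: "t > 0 \<Longrightarrow> (L' has_real_derivative L'' t) (at t)"
proof -
  have *: "at t within {0..} = at t" if "t > 0"
    using that by (intro at_within_interior) simp
  show "t > 0 \<Longrightarrow> (L has_real_derivative L' t) (at t)" "t > 0 \<Longrightarrow> (L' has_real_derivative L'' t) (at t)"
    using L_deriv[of t] L'_deriv[of t] * by auto
qed

text \<open>The growth rate of the weight that offsets the worst-case decay of a mean with profile \<open>k\<close>.\<close>

definition rate :: "real \<Rightarrow> real \<Rightarrow> real" where
  "rate k t = D * (pi * k / L t)\<^sup>2 - r + L t * neg_part (L'' t) / (4 * D)"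

text \<open>
  The logarithm of the weight.  Its \<open>\<xi>\<close>-dependent term removes the drift \<open>\<xi> (L'/L) u\<^sub>y\<close>
  at the cost of a potential \<open>\<xi>\<^sup>2 L L'' / (4D)\<close>; the other two terms compensate decay and the change
  of length.
\<close>

definition log_weight :: "real \<Rightarrow> real \<Rightarrow> real \<Rightarrow> real" where
  "log_weight k \<xi> t = \<xi>\<^sup>2 * (L t * L' t) / (4 * D) + integral {0..t} (rate k) + ln (L t) / 2"

text \<open>The weighted mean of the solution against the \<open>k\<close>-th profile.\<close>

definition mean :: "real \<Rightarrow> real \<Rightarrow> real" where
  "mean k t = integral (core k) (\<lambda>\<xi>. u \<xi> t * exp (log_weight k \<xi> t) * profile k \<xi>)"

lemma rate_cont: "continuous_on {0..} (rate k)"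
proof -
  have "L t \<noteq> 0" if "t \<in> {0..}" for t
    using L_pos[of t] that by simp
  then show ?thesis
    unfolding rate_def neg_part_def using D_pos
    by (intro continuous_intros L_cont L''_cont) auto
qed

lemma rate_integral_deriv:
  assumes "t > 0"
  shows "((\<lambda>s. integral {0..s} (rate k)) has_real_derivative rate k t) (at t)"
proof -
  have "((\<lambda>s. integral {0..s} (rate k)) has_real_derivative rate k t) (at t within {0..t+1})"
    using assms by (intro integral_has_real_derivative continuous_on_subset[OF rate_cont]) auto
  moreover have "at t within {0..t+1} = at t"
    using assms by (intro at_within_interior) simp
  ultimately show ?thesis
    by argo
qed

lemma rate_integral_cont: "continuous_on {0..T} (\<lambda>t. integral {0..t} (rate k))"
  by (intro indefinite_integral_continuous_1 integrable_continuous_real continuous_on_subset[OF rate_cont]) auto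

lemma log_weight_cont:
  assumes "continuous_on S f" "continuous_on S g" "\<And>p. p \<in> S \<Longrightarrow> g p \<in> {0..T}"
  shows "continuous_on S (\<lambda>p. log_weight k (f p) (g p))"
proof -
  have "continuous_on S (\<lambda>p. L (g p))" "continuous_on S (\<lambda>p. L' (g p))"
    "continuous_on S (\<lambda>p. integral {0..g p} (rate k))"
    by (rule continuous_on_compose2[OF L_cont assms(2)] continuous_on_compose2[OF L'_cont assms(2)]
          continuous_on_compose2[OF rate_integral_cont[of T k] assms(2)], use assms(3) in fastforce)+
  then show ?thesis
    unfolding log_weight_def using D_pos assms L_pos
    by (intro continuous_intros assms) (auto, metis L_pos less_irrefl)
qed

lemma log_weight_t_deriv:
  assumes "t > 0"
  shows "((\<lambda>s. log_weight k \<xi> s) has_real_derivative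
    \<xi>\<^sup>2 * ((L' t)\<^sup>2 + L t * L'' t) / (4 * D) + rate k t + L' t / (2 * L t)) (at t)"
  unfolding log_weight_def using L_pos[of t] assms D_pos
  by (auto intro!: derivative_eq_intros L_deriv_at L'_deriv_at rate_integral_deriv
      simp: power2_eq_square field_simps)

lemma log_weight_y_deriv:
  "((\<lambda>y. log_weight k y t) has_real_derivative \<xi> * (L t * L' t) / (2 * D)) (at \<xi>)"
  unfolding log_weight_def using D_pos
  by (auto intro!: derivative_eq_intros simp: field_simps)

lemma profile_deriv: "(profile k has_real_derivative - pi * k * sin (pi * k * (\<xi> - 1/2))) (at \<xi>)"
  unfolding profile_def
  by (auto intro!: derivative_eq_intros)

text \<open>The time derivative of the integrand of \<open>mean k\<close>.\<close>

definition mean_rate :: "real \<Rightarrow> real \<Rightarrow> real \<Rightarrow> real" where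
  "mean_rate k t \<xi> = (u\<^sub>t \<xi> t + u \<xi> t * (\<xi>\<^sup>2 * ((L' t)\<^sup>2 + L t * L'' t) / (4 * D) + rate k t + L' t / (2 * L t)))
     * exp (log_weight k \<xi> t) * profile k \<xi>"

lemma mean_cont:
  assumes "1 \<le> k"
  shows "continuous_on {0..T} (mean k)"
proof -
  have sub: "core k \<subseteq> {0..1}"
    using core_mono[of 1 k] assms by auto
  have "continuous_on ({0..T} \<times> cbox (1/2 - 1/(2*k)) (1/2 + 1/(2*k)))
     (\<lambda>(t, \<xi>). u \<xi> t * exp (log_weight k \<xi> t) * profile k \<xi>)"
    unfolding split_beta cbox_interval using sub
    by (intro continuous_intros continuous_on_pair_compose[OF u_cont] log_weight_cont[where T = T])
      (auto simp: subset_iff)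
  from integral_continuous_on_param[OF this] show ?thesis
    unfolding mean_def[abs_def] cbox_interval .
qed

lemma mean_rate_cont:
  assumes "core k \<subseteq> {0<..<1}"
  shows "continuous_on ({0<..<T} \<times> core k) (\<lambda>(t, \<xi>). mean_rate k t \<xi>)"
proof -
  let ?S = "{0<..<T} \<times> core k"
  have t: "continuous_on ?S (\<lambda>p. f (fst p))" if "continuous_on {0..} f" for f :: "real \<Rightarrow> real"
    by (rule continuous_on_compose2[OF that]) (auto intro!: continuous_intros)
  have "continuous_on ?S (\<lambda>p. u (snd p) (fst p))" "continuous_on ?S (\<lambda>p. u\<^sub>t (snd p) (fst p))"
    using assms
    by (auto intro!: continuous_intros continuous_on_pair_compose[OF u_cont] continuous_on_pair_compose[OF ut_cont]
        simp: subset_iff less_imp_le)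
  moreover have "continuous_on ?S (\<lambda>p. log_weight k (snd p) (fst p))"
    by (intro log_weight_cont[where T = T] continuous_intros) auto
  ultimately show ?thesis
    unfolding mean_rate_def split_beta using L_pos D_pos
    by (intro continuous_intros t L_cont L'_cont L''_cont rate_cont)
      (auto, metis L_pos less_imp_le less_irrefl)
qed

lemma mean_deriv:
  assumes "1 < k" "t > 0"
  shows "(mean k has_real_derivative integral (core k) (mean_rate k t)) (at t)"
proof -
  note sub = core_subset_open[OF assms(1)]
  let ?a = "1/2 - 1/(2*k)" and ?b = "1/2 + 1/(2*k)" and ?U = "{0<..<t+1}"
  have "((\<lambda>s. integral (cbox ?a ?b) (\<lambda>\<xi>. u \<xi> s * exp (log_weight k \<xi> s) * profile k \<xi>))
     has_real_derivative integral (cbox ?a ?b) (mean_rate k t)) (at t within ?U)"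
  proof (rule leibniz_rule_field_derivative)
    fix s \<xi> assume s: "s \<in> ?U" and \<xi>: "\<xi> \<in> cbox ?a ?b"
    have "((\<lambda>s. u \<xi> s * exp (log_weight k \<xi> s) * profile k \<xi>) has_real_derivative mean_rate k s \<xi>) (at s)"
      unfolding mean_rate_def using s \<xi> sub
      by (auto intro!: derivative_eq_intros ut_deriv log_weight_t_deriv simp: subset_iff algebra_simps)
    then show "((\<lambda>s. u \<xi> s * exp (log_weight k \<xi> s) * profile k \<xi>) has_real_derivative mean_rate k s \<xi>) (at s within ?U)"
      by (rule has_field_derivative_at_within)
  next
    fix s assume s: "s \<in> ?U"
    show "(\<lambda>\<xi>. u \<xi> s * exp (log_weight k \<xi> s) * profile k \<xi>) integrable_on cbox ?a ?b"
      unfolding cbox_interval using s sub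
      by (intro integrable_continuous_real continuous_intros continuous_on_pair_compose[OF u_cont]
          log_weight_cont[where T = s]) (auto simp: subset_iff less_imp_le)
  qed (use assms mean_rate_cont[OF sub] in auto)
  moreover have "at t within ?U = at t"
    using assms by (intro at_within_open) auto
  ultimately show ?thesis
    unfolding mean_def[abs_def] cbox_interval by argo
qed

text \<open>
  Writing \<open>P\<close> for weight times profile, this is \<open>(D / L\<^sup>2) (u\<^sub>y P - u P\<^sub>y) + (L'/L) \<xi> u P\<close>: the boundary
  term that two integrations by parts of the diffusion and one of the drift produce.
\<close>

definition flux :: "real \<Rightarrow> real \<Rightarrow> real \<Rightarrow> real" where
  "flux k t \<xi> = exp (log_weight k \<xi> t) *
     (D / (L t)\<^sup>2 * (u\<^sub>y \<xi> t * profile k \<xi>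
        - u \<xi> t * (\<xi> * (L t * L' t) / (2 * D) * profile k \<xi> - pi * k * sin (pi * k * (\<xi> - 1/2))))
      + L' t / L t * (\<xi> * u \<xi> t * profile k \<xi>))"

text \<open>
  The density \<open>mean_rate\<close> is the derivative of the flux plus a remainder, and the remainder is
  nonnegative on \<open>[0,1]\<close> because \<open>\<xi>\<^sup>2 L'' \<ge> - [L'']\<^sup>-\<close> there.
\<close>

lemma flux_deriv:
  assumes "\<xi> \<in> {0<..<1}" "t > 0"
  shows "(flux k t has_real_derivative
    mean_rate k t \<xi> - u \<xi> t * exp (log_weight k \<xi> t) * profile k \<xi> *
      (\<xi>\<^sup>2 * (L t * L'' t) + L t * neg_part (L'' t)) / (4 * D)) (at \<xi>)"
proof -
  have pos: "L t > 0" "D > 0"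
    using L_pos[of t] D_pos assms by auto
  \<comment> \<open>In these abbreviations the drift coefficient and \<open>(L')\<^sup>2\<close> are monomials (\<open>A\<close> and \<open>L'2\<close>), so that
     the claim becomes a polynomial identity.\<close>
  define d where "d = D / (L t)\<^sup>2"
  define c where "c = L t * L' t / (2 * D)"
  define \<kappa> where "\<kappa> = pi * k"
  define s where "s y = sin (\<kappa> * (y - 1/2))" for y
  define e where "e = exp (log_weight k \<xi> t)"
  define P where "P = profile k \<xi>"
  have A: "L' t / L t = 2 * d * c"
    unfolding d_def c_def using pos by (simp add: power2_eq_square)
  have L'2: "(L' t)\<^sup>2 / (4 * D) = d * c\<^sup>2"
    unfolding d_def c_def using pos by (simp add: power2_eq_square)
  have w: "((\<lambda>y. exp (log_weight k y t)) has_real_derivative e * (\<xi> * c)) (at \<xi>)"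
    unfolding e_def c_def by (auto intro!: derivative_eq_intros log_weight_y_deriv)
  have p: "(profile k has_real_derivative - (\<kappa> * s \<xi>)) (at \<xi>)"
    using profile_deriv[of k \<xi>] by (simp add: s_def \<kappa>_def)
  have s': "(s has_real_derivative \<kappa> * P) (at \<xi>)"
    unfolding s_def P_def profile_def \<kappa>_def by (auto intro!: derivative_eq_intros)
  have flux: "flux k t = (\<lambda>y. exp (log_weight k y t) *
     (d * (u\<^sub>y y t * profile k y - u y t * (y * c * profile k y - \<kappa> * s y))
      + 2 * d * c * (y * u y t * profile k y)))"
    unfolding flux_def[abs_def] A by (simp add: d_def c_def s_def \<kappa>_def)
  have "(flux k t has_real_derivative
      e * (\<xi> * c) * (d * (u\<^sub>y \<xi> t * P - u \<xi> t * (\<xi> * c * P - \<kappa> * s \<xi>)) + 2 * d * c * (\<xi> * u \<xi> t * P))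
    + e * (d * (u\<^sub>y\<^sub>y \<xi> t * P - u\<^sub>y \<xi> t * (\<kappa> * s \<xi>)
         - (u\<^sub>y \<xi> t * (\<xi> * c * P - \<kappa> * s \<xi>)
            + u \<xi> t * (c * P - \<xi> * c * (\<kappa> * s \<xi>) - \<kappa> * (\<kappa> * P))))
       + 2 * d * c * (u \<xi> t * P + \<xi> * u\<^sub>y \<xi> t * P - \<xi> * u \<xi> t * (\<kappa> * s \<xi>)))) (at \<xi>)"
    unfolding flux
    by (rule derivative_eq_intros w p s' uy_deriv[OF assms] uyy_deriv[OF assms] refl)+
      (simp add: e_def[symmetric] P_def[symmetric] algebra_simps)
  moreover have "mean_rate k t \<xi> - u \<xi> t * e * P * (\<xi>\<^sup>2 * (L t * L'' t) + L t * neg_part (L'' t)) / (4 * D)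
    = (d * u\<^sub>y\<^sub>y \<xi> t + \<xi> * (2 * d * c) * u\<^sub>y \<xi> t + u \<xi> t * (\<xi>\<^sup>2 * (d * c\<^sup>2) + d * \<kappa>\<^sup>2 + d * c)) * e * P"
  proof -
    define X where "X = (\<xi>\<^sup>2 * (L t * L'' t) + L t * neg_part (L'' t)) / (4 * D)"
    have 1: "\<xi>\<^sup>2 * ((L' t)\<^sup>2 + L t * L'' t) / (4 * D) + rate k t + L' t / (2 * L t)
      = \<xi>\<^sup>2 * (d * c\<^sup>2) + d * \<kappa>\<^sup>2 + d * c - r + X"
      using A unfolding L'2[symmetric] rate_def X_def
      by (simp add: d_def \<kappa>_def power_divide add_divide_distrib distrib_left)
    have 2: "\<xi> * L' t / L t = \<xi> * (2 * d * c)"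
      unfolding A[symmetric] by simp
    have 3: "u \<xi> t * e * P * (\<xi>\<^sup>2 * (L t * L'' t) + L t * neg_part (L'' t)) / (4 * D) = u \<xi> t * e * P * X"
      by (simp add: X_def)
    show ?thesis
      unfolding mean_rate_def pde[OF assms] 1 2 3 e_def[symmetric] P_def[symmetric] d_def[symmetric]
      by (simp add: algebra_simps)
  qed
  ultimately show ?thesis
    unfolding e_def[symmetric] P_def[symmetric]
    by (elim DERIV_cong) (simp add: power2_eq_square algebra_simps)
qed

text \<open>
  At the ends of the core the profile vanishes and slopes inwards, so only \<open>- u P\<^sub>y\<close> survives in
  the flux, with the sign given by \<open>u \<ge> 0\<close>.
\<close>

lemma flux_ends:
  assumes "1 < k" "t > 0"
  shows "flux k t (1/2 - 1/(2*k)) \<le> 0" "0 \<le> flux k t (1/2 + 1/(2*k))"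
proof -
  let ?a = "1/2 - 1/(2*k)" and ?b = "1/2 + 1/(2*k)"
  have "?a \<in> core k" "?b \<in> core k"
    using assms by auto
  then have "0 \<le> u ?a t" "0 \<le> u ?b t"
    using core_subset_open[OF assms(1)] assms by (auto intro!: u_nonneg simp: subset_iff less_imp_le)
  moreover have "flux k t ?a = - (exp (log_weight k ?a t) * (D / (L t)\<^sup>2 * (u ?a t * (pi * k))))"
    "flux k t ?b = exp (log_weight k ?b t) * (D / (L t)\<^sup>2 * (u ?b t * (pi * k)))"
    unfolding flux_def using assms profile_ends[of k] by (simp_all del: diff_divide_distrib)
  ultimately show "flux k t ?a \<le> 0" "0 \<le> flux k t ?b"
    using D_pos assms by auto
qed

lemma mean_rate_nonneg:
  assumes "1 < k" "t > 0"
  shows "0 \<le> integral (core k) (mean_rate k t)"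
proof -
  let ?a = "1/2 - 1/(2*k)" and ?b = "1/2 + 1/(2*k)"
  note sub = core_subset_open[OF assms(1)]
  define gain where "gain \<xi> = u \<xi> t * exp (log_weight k \<xi> t) * profile k \<xi> *
      (\<xi>\<^sup>2 * (L t * L'' t) + L t * neg_part (L'' t)) / (4 * D)" for \<xi>
  have gain: "0 \<le> gain \<xi>" if \<xi>: "\<xi> \<in> core k" for \<xi>
  proof -
    have \<xi>01: "0 < \<xi>" "\<xi> < 1"
      using \<xi> sub by (auto simp: subset_iff)
    have "\<xi>\<^sup>2 \<le> 1"
      using \<xi>01 by (intro power_le_one) auto
    then have "\<xi>\<^sup>2 * neg_part (L'' t) \<le> 1 * neg_part (L'' t)"
      by (intro mult_right_mono) (auto simp: neg_part_def)
    moreover have "\<xi>\<^sup>2 * (- neg_part (L'' t)) \<le> \<xi>\<^sup>2 * L'' t"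
      by (intro mult_left_mono) (auto simp: neg_part_def)
    ultimately have "0 \<le> L t * (\<xi>\<^sup>2 * L'' t + neg_part (L'' t))"
      using L_pos[of t] assms by (intro mult_nonneg_nonneg) auto
    then have "0 \<le> \<xi>\<^sup>2 * (L t * L'' t) + L t * neg_part (L'' t)"
      by (simp add: algebra_simps)
    then show ?thesis
      unfolding gain_def using u_nonneg[of \<xi> t] profile_nonneg[of k \<xi>] \<xi> \<xi>01 assms D_pos by auto
  qed
  have "((\<lambda>\<xi>. mean_rate k t \<xi> - gain \<xi>) has_integral (flux k t ?b - flux k t ?a)) (core k)"
  proof (rule fundamental_theorem_of_calculus)
    show "?a \<le> ?b"
      using assms by simp
    show "(flux k t has_vector_derivative mean_rate k t \<xi> - gain \<xi>) (at \<xi> within core k)" if "\<xi> \<in> core k" for \<xi>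
      using flux_deriv[of \<xi> t k] that sub assms unfolding gain_def
      by (auto intro!: has_vector_derivative_at_within simp: has_real_derivative_iff_has_vector_derivative subset_iff)
  qed
  moreover have "mean_rate k t integrable_on core k"
  proof (rule integrable_continuous_real)
    show "continuous_on (core k) (mean_rate k t)"
      using assms
      by (intro continuous_on_pair_compose[OF mean_rate_cont[OF sub, of "t+1"]] continuous_intros) auto
  qed
  ultimately have "flux k t ?b - flux k t ?a \<le> integral (core k) (mean_rate k t)"
    using gain by (intro has_integral_le[OF _ integrable_integral]) auto
  then show ?thesis
    using flux_ends[OF assms] by linarith
qed

lemma mean_mono:
  assumes "1 < k" "0 \<le> t"
  shows "mean k 0 \<le> mean k t"
proof (rule DERIV_nonneg_imp_increasing_open[OF assms(2)])
  show "\<exists>y. (mean k has_real_derivative y) (at s) \<and> 0 \<le> y" if "0 < s" for s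
    using mean_deriv[OF assms(1) that] mean_rate_nonneg[OF assms(1) that] by blast
  show "continuous_on {0..t} (mean k)"
    using assms by (intro mean_cont) auto
qed

lemma rate_split: "rate k t = rate 1 t + (k\<^sup>2 - 1) * (D * (pi / L t)\<^sup>2)"
  unfolding rate_def by (simp add: power_divide power_mult_distrib algebra_simps diff_divide_distrib)

text \<open>
  The constants in the bounds on \<open>L\<close>, \<open>L' L\<close> and the integrated rate may depend on everything but
  \<open>t\<close>; these bounds make the weight bounded above by \<open>exp M\<close>.
\<close>

lemma projection_lower_bound:
  assumes L_le: "\<And>t. t \<ge> 0 \<Longrightarrow> L t \<le> \<Lambda>"
    and LL'_le: "\<And>t. t \<ge> 0 \<Longrightarrow> L' t * L t \<le> B"
    and rate_le: "\<And>t. t \<ge> 0 \<Longrightarrow> integral {0..t} (rate 1) \<le> C"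
    and \<xi>\<^sub>0: "\<xi>\<^sub>0 \<in> {0<..<1}" "u \<xi>\<^sub>0 0 \<noteq> 0"
  obtains c where "c > 0" "\<And>t. t \<ge> 0 \<Longrightarrow> c \<le> integral {0..1} (\<lambda>\<xi>. u \<xi> t * sin (pi * \<xi>))"
proof -
  define m where "m = \<bar>\<xi>\<^sub>0 - 1/2\<bar>"
  \<comment> \<open>The half-width \<open>(1 + 2 m) / 4\<close> of \<open>core k\<^sub>0\<close> is midway between \<open>m\<close> and \<open>1/2\<close>.\<close>
  define k\<^sub>0 where "k\<^sub>0 = 2 / (1 + 2 * m)"
  have m: "0 \<le> m" "m < 1/2"
    using \<xi>\<^sub>0(1) unfolding m_def by (auto simp: abs_if)
  have k0: "1 < k\<^sub>0"
    unfolding k\<^sub>0_def using m by (simp add: field_simps)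
  have half: "1 / (2 * k\<^sub>0) = (1 + 2 * m) / 4"
    unfolding k\<^sub>0_def using m by (simp add: field_simps)
  have "\<xi>\<^sub>0 - 1/2 \<le> m" "- m \<le> \<xi>\<^sub>0 - 1/2"
    unfolding m_def by linarith+
  then have \<xi>0_core: "\<xi>\<^sub>0 \<in> core k\<^sub>0"
    unfolding half atLeastAtMost_iff using m by (intro conjI) (simp_all add: field_simps)
  have sub01: "core k \<subseteq> {0..1}" if "1 \<le> k" for k
    using core_mono[of 1 k] that by auto
  have h_cont: "continuous_on {0..1} (\<lambda>\<xi>. u \<xi> t * exp (log_weight k \<xi> t))" if "t \<ge> 0" for k t
    using that by (intro continuous_intros continuous_on_pair_compose[OF u_cont] log_weight_cont[where T = t]) auto
  have h_nonneg: "0 \<le> u \<xi> t * exp (log_weight k \<xi> t)" if "t \<ge> 0" "\<xi> \<in> {0..1}" for k t \<xi>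
    using u_nonneg that by simp
  have mean_pos: "0 < mean k\<^sub>0 0"
  proof -
    let ?f = "\<lambda>\<xi>. u \<xi> 0 * exp (log_weight k\<^sub>0 \<xi> 0) * profile k\<^sub>0 \<xi>"
    have cont: "continuous_on (core k\<^sub>0) ?f"
      using sub01[of k\<^sub>0] k0 by (intro continuous_intros continuous_on_subset[OF h_cont]) auto
    have nonneg: "0 \<le> ?f \<xi>" if "\<xi> \<in> core k\<^sub>0" for \<xi>
    proof (rule mult_nonneg_nonneg)
      show "0 \<le> u \<xi> 0 * exp (log_weight k\<^sub>0 \<xi> 0)"
        using that sub01[of k\<^sub>0] k0 by (intro h_nonneg) auto
      show "0 \<le> profile k\<^sub>0 \<xi>"
        using that k0 by (intro profile_nonneg) auto
    qed
    have "0 < profile k\<^sub>0 \<xi>\<^sub>0"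
    proof -
      have "\<bar>pi * k\<^sub>0 * (\<xi>\<^sub>0 - 1/2)\<bar> = pi * (k\<^sub>0 * m)"
        using k0 by (simp add: abs_mult m_def)
      moreover have "k\<^sub>0 * m < 1/2"
        unfolding k\<^sub>0_def using m by (simp add: field_simps)
      then have "pi * (k\<^sub>0 * m) < pi * (1/2)"
        by (intro mult_strict_left_mono) auto
      ultimately show ?thesis
        unfolding profile_def by (intro cos_gt_zero_pi) linarith+
    qed
    then have "?f \<xi>\<^sub>0 \<noteq> 0"
      using \<xi>\<^sub>0 by simp
    then have "integral (core k\<^sub>0) ?f \<noteq> 0"
      using integral_eq_0_iff[OF cont _ nonneg] \<xi>0_core k0 by auto
    moreover have "0 \<le> integral (core k\<^sub>0) ?f"
      using nonneg by (intro integral_nonneg integrable_continuous_real cont)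
    ultimately show ?thesis
      unfolding mean_def by simp
  qed
  define M where "M = \<bar>B\<bar> / (4 * D) + (C + 1) + ln \<Lambda> / 2"
  show thesis
  proof (rule that)
    show "0 < mean k\<^sub>0 0 * exp (- M)"
      using mean_pos by simp
  next
    fix t :: real assume t: "t \<ge> 0"
    define J where "J = integral {0..t} (\<lambda>s. D * (pi / L s)\<^sup>2)"
    have J_int: "(\<lambda>s. D * (pi / L s)\<^sup>2) integrable_on {0..t}"
    proof (intro integrable_continuous_real continuous_intros continuous_on_subset[OF L_cont])
      show "\<forall>s\<in>{0..t}. L s \<noteq> 0"
        using L_pos by (metis atLeastAtMost_iff less_irrefl)
    qed auto
    have J: "0 \<le> J"
      unfolding J_def using D_pos by (intro integral_nonneg J_int) auto
    \<comment> \<open>The parameter \<open>k\<close> depends on \<open>t\<close> and makes the extra decay \<open>(k\<^sup>2 - 1) J\<close> at most \<open>1\<close>.\<close>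
    define k where "k = min k\<^sub>0 (sqrt (1 + 1 / (J + 1)))"
    have k: "1 < k" "k \<le> k\<^sub>0"
      unfolding k_def using k0 J by auto
    have "k\<^sup>2 \<le> (sqrt (1 + 1 / (J + 1)))\<^sup>2"
      using k unfolding k_def by (intro power_mono) auto
    also have "\<dots> = 1 + 1 / (J + 1)"
      using J by simp
    finally have "(k\<^sup>2 - 1) * J \<le> 1 / (J + 1) * J"
      using J by (intro mult_right_mono) auto
    also have "\<dots> \<le> 1"
      using J by (simp add: field_simps)
    finally have kJ: "(k\<^sup>2 - 1) * J \<le> 1" .
    have "integral {0..t} (rate k) = integral {0..t} (\<lambda>s. rate 1 s + (k\<^sup>2 - 1) * (D * (pi / L s)\<^sup>2))"
      by (intro integral_cong rate_split)
    also have "\<dots> = integral {0..t} (rate 1) + integral {0..t} (\<lambda>s. (k\<^sup>2 - 1) * (D * (pi / L s)\<^sup>2))"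
      by (intro integral_add integrable_on_mult_right J_int integrable_continuous_real
          continuous_on_subset[OF rate_cont]) auto
    also have "integral {0..t} (\<lambda>s. (k\<^sup>2 - 1) * (D * (pi / L s)\<^sup>2)) = (k\<^sup>2 - 1) * J"
      unfolding J_def by (rule integral_mult_right)
    finally have rate_k: "integral {0..t} (rate k) \<le> C + 1"
      using rate_le[OF t] kJ by linarith
    have weight_le: "log_weight k \<xi> t \<le> M" if \<xi>: "\<xi> \<in> {0..1}" for \<xi>
    proof -
      have "\<xi>\<^sup>2 * (L t * L' t) \<le> \<xi>\<^sup>2 * \<bar>B\<bar>"
        using LL'_le[OF t] by (intro mult_left_mono) (auto simp: mult.commute)
      also have "\<dots> \<le> 1 * \<bar>B\<bar>"
        using \<xi> by (intro mult_right_mono power_le_one) auto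
      finally have "\<xi>\<^sup>2 * (L t * L' t) / (4 * D) \<le> \<bar>B\<bar> / (4 * D)"
        using D_pos by (intro divide_right_mono) auto
      moreover have "ln (L t) \<le> ln \<Lambda>"
        using L_le[OF t] L_pos[OF t] by simp
      ultimately show ?thesis
        unfolding log_weight_def M_def using rate_k by linarith
    qed
    have sin_int: "(\<lambda>\<xi>. u \<xi> t * sin (pi * \<xi>)) integrable_on {0..1}"
      using t by (intro integrable_continuous_real continuous_intros continuous_on_pair_compose[OF u_cont]) auto
    \<comment> \<open>At time \<open>0\<close> the weight does not depend on \<open>k\<close>.\<close>
    have "mean k\<^sub>0 0 = integral (core k\<^sub>0) (\<lambda>\<xi>. u \<xi> 0 * exp (log_weight k \<xi> 0) * profile k\<^sub>0 \<xi>)"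
      unfolding mean_def log_weight_def by simp
    also have "\<dots> \<le> mean k 0"
      unfolding mean_def using k by (intro profile_mean_antimono h_cont h_nonneg) auto
    also have "\<dots> \<le> mean k t"
      using k t by (intro mean_mono) auto
    also have "\<dots> \<le> integral (core 1) (\<lambda>\<xi>. u \<xi> t * exp (log_weight k \<xi> t) * profile 1 \<xi>)"
      unfolding mean_def using k t by (intro profile_mean_antimono h_cont h_nonneg) auto
    also have "\<dots> = integral {0..1} (\<lambda>\<xi>. u \<xi> t * exp (log_weight k \<xi> t) * sin (pi * \<xi>))"
      by (simp add: profile_1)
    also have "\<dots> \<le> integral {0..1} (\<lambda>\<xi>. exp M * (u \<xi> t * sin (pi * \<xi>)))"
    proof (rule integral_le)
      show "(\<lambda>\<xi>. u \<xi> t * exp (log_weight k \<xi> t) * sin (pi * \<xi>)) integrable_on {0..1}"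
        using t by (intro integrable_continuous_real continuous_intros h_cont)
      show "(\<lambda>\<xi>. exp M * (u \<xi> t * sin (pi * \<xi>))) integrable_on {0..1}"
        by (intro integrable_on_mult_right sin_int)
      fix \<xi> :: real assume \<xi>: "\<xi> \<in> {0..1}"
      have "0 \<le> sin (pi * \<xi>)"
        using \<xi> by (intro sin_ge_zero) (auto simp: mult_left_le)
      then have "0 \<le> u \<xi> t * sin (pi * \<xi>)"
        using u_nonneg[OF \<xi> t] by simp
      then have "exp (log_weight k \<xi> t) * (u \<xi> t * sin (pi * \<xi>)) \<le> exp M * (u \<xi> t * sin (pi * \<xi>))"
        using weight_le[OF \<xi>] by (intro mult_right_mono) auto
      then show "u \<xi> t * exp (log_weight k \<xi> t) * sin (pi * \<xi>) \<le> exp M * (u \<xi> t * sin (pi * \<xi>))"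
        by (simp add: mult_ac)
    qed
    also have "\<dots> = exp M * integral {0..1} (\<lambda>\<xi>. u \<xi> t * sin (pi * \<xi>))"
      by (rule integral_mult_right)
    finally show "mean k\<^sub>0 0 * exp (- M) \<le> integral {0..1} (\<lambda>\<xi>. u \<xi> t * sin (pi * \<xi>))"
      by (simp add: exp_minus field_simps)
  qed
qed

end

section \<open>Straightening the moving boundary\<close>

text \<open>
  The chain rule along a curve \<open>(\<gamma> s, s)\<close>, where only the partial derivative in the
  second variable is continuous.
\<close>

lemma DERIV_along_curve:
  fixes f :: "real \<Rightarrow> real \<Rightarrow> real"
  assumes "open S" "(\<gamma> t, t) \<in> S"
    and ft: "\<And>x s. (x, s) \<in> S \<Longrightarrow> ((\<lambda>s. f x s) has_real_derivative f\<^sub>t x s) (at s)"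
    and ft_cont: "continuous_on S (\<lambda>(x, s). f\<^sub>t x s)"
    and fx: "((\<lambda>x. f x t) has_real_derivative f\<^sub>x) (at (\<gamma> t))"
    and \<gamma>: "(\<gamma> has_real_derivative \<gamma>') (at t)"
  shows "((\<lambda>s. f (\<gamma> s) s) has_real_derivative f\<^sub>x * \<gamma>' + f\<^sub>t (\<gamma> t) t) (at t)"
proof -
  obtain X Y' where XY': "open X" "open Y'" "\<gamma> t \<in> X" "t \<in> Y'" "X \<times> Y' \<subseteq> S"
    using open_prod_elim[OF assms(1,2)] by (metis mem_Sigma_iff)
  obtain e where e: "e > 0" "ball t e \<subseteq> Y'"
    using XY' by (meson openE)
  let ?Y = "ball t e"
  have sub: "X \<times> ?Y \<subseteq> S"
    using XY' e by auto
  have "continuous_on (X \<times> ?Y) (\<lambda>p. blinfun_mult_right (f\<^sub>t (fst p) (snd p)))"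
    using continuous_on_subset[OF ft_cont sub]
    by (intro bounded_linear.continuous_on[OF bounded_linear_blinfun_mult_right]) (simp add: split_beta)
  then have ft_cont': "continuous (at (\<gamma> t, t) within X \<times> ?Y) (\<lambda>(x, s). blinfun_mult_right (f\<^sub>t x s))"
    using XY' e unfolding continuous_on_eq_continuous_within split_beta by auto
  have "((\<lambda>(x, s). f x s) has_derivative
      (\<lambda>(dx, ds). f\<^sub>x * dx + blinfun_mult_right (f\<^sub>t (\<gamma> t) t) ds)) (at (\<gamma> t, t) within X \<times> ?Y)"
  proof (rule has_derivative_partialsI[OF _ _ ft_cont'])
    show "((\<lambda>x. f x t) has_derivative (*) f\<^sub>x) (at (\<gamma> t) within X)"
      using fx has_derivative_at_withinI unfolding has_field_derivative_def by blast
    show "((\<lambda>s. f x s) has_derivative blinfun_apply (blinfun_mult_right (f\<^sub>t x s))) (at s within ?Y)"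
      if "x \<in> X" "s \<in> ?Y" for x s
      using ft[of x s] sub that has_derivative_at_withinI
      unfolding has_field_derivative_def blinfun_mult_right.rep_eq by blast
  qed (use e in auto)
  moreover have "at (\<gamma> t, t) within X \<times> ?Y = at (\<gamma> t, t)"
    using XY' e by (intro at_within_open open_Times) auto
  ultimately have f: "((\<lambda>(x, s). f x s) has_derivative (\<lambda>(dx, ds). f\<^sub>x * dx + f\<^sub>t (\<gamma> t) t * ds)) (at (\<gamma> t, t))"
    by (simp add: blinfun_mult_right.rep_eq)
  have "((\<lambda>s. (\<gamma> s, s)) has_derivative (\<lambda>h. (\<gamma>' * h, h))) (at t)"
    using \<gamma> unfolding has_field_derivative_def by (intro has_derivative_Pair has_derivative_ident)
  note has_derivative_compose[OF this f]
  moreover have "(\<lambda>h. f\<^sub>x * (\<gamma>' * h) + f\<^sub>t (\<gamma> t) t * h) = (*) (f\<^sub>x * \<gamma>' + f\<^sub>t (\<gamma> t) t)"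
    by (simp add: fun_eq_iff algebra_simps)
  ultimately show ?thesis
    by (simp only: has_field_derivative_def split_conv)
qed

lemma open_moving_domain:
  assumes "continuous_on {0..} L"
  shows "open (moving_domain L)"
proof -
  \<comment> \<open>Clamping time at \<open>0\<close> extends \<open>L\<close> continuously to the whole line.\<close>
  have "continuous_on UNIV (\<lambda>p. L (max (snd p) 0))"
    by (rule continuous_on_compose2[OF assms]) (auto intro!: continuous_intros)
  moreover have "moving_domain L = {p. 0 < snd p} \<inter> {p. 0 < fst p} \<inter> {p. fst p < L (max (snd p) 0)}"
    by (auto simp: moving_domain_def)
  ultimately show ?thesis
    by (auto intro!: open_Int open_Collect_less continuous_intros)
qed

lemma straightening:
  assumes D_pos: "D > 0"
    and L_pos: "\<And>t. t \<ge> 0 \<Longrightarrow> L t > 0"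
    and L_deriv: "\<And>t. t \<ge> 0 \<Longrightarrow> (L has_real_derivative L' t) (at t within {0..})"
    and L'_deriv: "\<And>t. t \<ge> 0 \<Longrightarrow> (L' has_real_derivative L'' t) (at t within {0..})"
    and L''_cont: "continuous_on {0..} L''"
    and sol: "classical_solution D r L \<psi>"
    and nonneg: "\<And>x t. t \<ge> 0 \<Longrightarrow> 0 \<le> x \<Longrightarrow> x \<le> L t \<Longrightarrow> \<psi> x t \<ge> 0"
  obtains u\<^sub>t u\<^sub>y u\<^sub>y\<^sub>y where
    "straightened_problem D r L L' L'' (\<lambda>\<xi> t. \<psi> (\<xi> * L t) t) u\<^sub>t u\<^sub>y u\<^sub>y\<^sub>y"
proof -
  obtain \<psi>\<^sub>t \<psi>\<^sub>x \<psi>\<^sub>x\<^sub>x where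
      cont: "continuous_on (closed_moving_domain L) (\<lambda>(x, t). \<psi> x t)"
      "continuous_on (moving_domain L) (\<lambda>(x, t). \<psi>\<^sub>t x t)"
      "continuous_on (moving_domain L) (\<lambda>(x, t). \<psi>\<^sub>x x t)"
    and "\<forall>(x, t) \<in> moving_domain L.
           ((\<lambda>s. \<psi> x s) has_real_derivative \<psi>\<^sub>t x t) (at t) \<and>
           ((\<lambda>y. \<psi> y t) has_real_derivative \<psi>\<^sub>x x t) (at x) \<and>
           ((\<lambda>y. \<psi>\<^sub>x y t) has_real_derivative \<psi>\<^sub>x\<^sub>x x t) (at x) \<and>
           \<psi>\<^sub>t x t = D * \<psi>\<^sub>x\<^sub>x x t + r * \<psi> x t"
    using sol unfolding classical_solution_def by blast
  then have \<psi>t: "((\<lambda>s. \<psi> x s) has_real_derivative \<psi>\<^sub>t x t) (at t)"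
    and \<psi>x: "((\<lambda>y. \<psi> y t) has_real_derivative \<psi>\<^sub>x x t) (at x)"
    and \<psi>xx: "((\<lambda>y. \<psi>\<^sub>x y t) has_real_derivative \<psi>\<^sub>x\<^sub>x x t) (at x)"
    and pde: "\<psi>\<^sub>t x t = D * \<psi>\<^sub>x\<^sub>x x t + r * \<psi> x t"
    if "(x, t) \<in> moving_domain L" for x t
    using that by fast+
  have L_cont: "continuous_on {0..} L" and L'_cont: "continuous_on {0..} L'"
    using L_deriv L'_deriv by (auto intro!: DERIV_continuous_on)
  have in_domain: "(\<xi> * L t, t) \<in> moving_domain L" if "\<xi> \<in> {0<..<1}" "t > 0" for \<xi> t
    using that L_pos[of t] by (simp add: moving_domain_def)
  have time: "continuous_on (A \<times> {0<..}) (\<lambda>p. f (snd p))" if "continuous_on {0..} f"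
    for A :: "real set" and f :: "real \<Rightarrow> real"
    by (rule continuous_on_compose2[OF that]) (auto intro!: continuous_intros)
  have interior: "continuous_on ({0<..<1} \<times> {0<..}) (\<lambda>p. f (fst p * L (snd p)) (snd p))"
    if "continuous_on (moving_domain L) (\<lambda>(x, t). f x t)" for f :: "real \<Rightarrow> real \<Rightarrow> real"
  proof -
    have "continuous_on ({0<..<1} \<times> {0<..}) (\<lambda>p. (fst p * L (snd p), snd p))"
      by (intro continuous_intros time L_cont)
    moreover have "(\<lambda>p. (fst p * L (snd p), snd p)) ` ({0<..<1} \<times> {0<..}) \<subseteq> moving_domain L"
      using in_domain by fastforce
    ultimately show ?thesis
      using continuous_on_compose2[OF that] by fastforce
  qed
  have "straightened_problem D r L L' L'' (\<lambda>\<xi> t. \<psi> (\<xi> * L t) t)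
     (\<lambda>\<xi> t. \<psi>\<^sub>x (\<xi> * L t) t * (\<xi> * L' t) + \<psi>\<^sub>t (\<xi> * L t) t)
     (\<lambda>\<xi> t. \<psi>\<^sub>x (\<xi> * L t) t * L t) (\<lambda>\<xi> t. \<psi>\<^sub>x\<^sub>x (\<xi> * L t) t * L t * L t)"
  proof
    have L_snd: "continuous_on ({0..1} \<times> {0..}) (\<lambda>p. L (snd p))"
      by (rule continuous_on_compose2[OF L_cont]) (auto intro!: continuous_intros)
    show "continuous_on ({0..1} \<times> {0..}) (\<lambda>(\<xi>, t). \<psi> (\<xi> * L t) t)"
    proof -
      have "continuous_on ({0..1} \<times> {0..}) (\<lambda>p. (fst p * L (snd p), snd p))"
        by (intro continuous_intros L_snd)
      moreover have "(\<lambda>p. (fst p * L (snd p), snd p)) ` ({0..1} \<times> {0..}) \<subseteq> closed_moving_domain L"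
        using L_pos by (auto simp: closed_moving_domain_def mult_left_le_one_le less_imp_le)
      ultimately show ?thesis
        using continuous_on_compose2[OF cont(1)] by (fastforce simp: split_beta)
    qed
    show "\<psi> (\<xi> * L t) t \<ge> 0" if "\<xi> \<in> {0..1}" "t \<ge> 0" for \<xi> t
      using that L_pos[of t] by (intro nonneg) (auto intro: mult_left_le_one_le)
    show "continuous_on ({0<..<1} \<times> {0<..}) (\<lambda>(\<xi>, t). \<psi>\<^sub>x (\<xi> * L t) t * (\<xi> * L' t) + \<psi>\<^sub>t (\<xi> * L t) t)"
      unfolding split_beta
      by (intro continuous_intros interior cont time L'_cont)
    fix \<xi> t :: real assume *: "\<xi> \<in> {0<..<1}" "t > 0"
    note dom = in_domain[OF *]
    have "at t within {0..} = at t"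
      using * by (intro at_within_interior) simp
    then have "((\<lambda>s. \<xi> * L s) has_real_derivative \<xi> * L' t) (at t)"
      using L_deriv[of t] * by (auto intro!: derivative_eq_intros)
    then show "((\<lambda>s. \<psi> (\<xi> * L s) s) has_real_derivative
        \<psi>\<^sub>x (\<xi> * L t) t * (\<xi> * L' t) + \<psi>\<^sub>t (\<xi> * L t) t) (at t)"
      using dom
      by (intro DERIV_along_curve[OF open_moving_domain[OF L_cont] _ \<psi>t cont(2) \<psi>x])
    have scale: "((\<lambda>y. y * L t) has_real_derivative L t) (at \<xi>)"
      by (auto intro!: derivative_eq_intros)
    show "((\<lambda>y. \<psi> (y * L t) t) has_real_derivative \<psi>\<^sub>x (\<xi> * L t) t * L t) (at \<xi>)"
      by (rule DERIV_chain2[OF \<psi>x[OF dom] scale])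
    show "((\<lambda>y. \<psi>\<^sub>x (y * L t) t * L t) has_real_derivative \<psi>\<^sub>x\<^sub>x (\<xi> * L t) t * L t * L t) (at \<xi>)"
      by (rule DERIV_cmult_right[OF DERIV_chain2[OF \<psi>xx[OF dom] scale]])
    show "\<psi>\<^sub>x (\<xi> * L t) t * (\<xi> * L' t) + \<psi>\<^sub>t (\<xi> * L t) t =
      D / (L t)\<^sup>2 * (\<psi>\<^sub>x\<^sub>x (\<xi> * L t) t * L t * L t) + \<xi> * L' t / L t * (\<psi>\<^sub>x (\<xi> * L t) t * L t)
        + r * \<psi> (\<xi> * L t) t"
      using L_pos[of t] * by (simp add: pde[OF dom] power2_eq_square)
  qed (use assms in auto)
  then show thesis
    by (rule that)
qed

section \<open>Persistence\<close>

theorem corollary3p1: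
  fixes D r :: real
    and L L' L'' :: "real \<Rightarrow> real"
    and \<psi> :: "real \<Rightarrow> real \<Rightarrow> real"
  assumes D_pos: "D > 0" and r_pos: "r > 0"
    and L_pos: "\<And>t. t \<ge> 0 \<Longrightarrow> L t > 0"
    and L_deriv: "\<And>t. t \<ge> 0 \<Longrightarrow> (L has_real_derivative L' t) (at t within {0..})"
    and L'_deriv: "\<And>t. t \<ge> 0 \<Longrightarrow> (L' has_real_derivative L'' t) (at t within {0..})"
    and L''_cont: "continuous_on {0..} L''"
    and sol: "classical_solution D r L \<psi>"
    and nonneg: "\<And>x t. t \<ge> 0 \<Longrightarrow> 0 \<le> x \<Longrightarrow> x \<le> L t \<Longrightarrow> \<psi> x t \<ge> 0"
    and cond_i_L: "bdd_above (L ` {0..})"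
    and cond_i_L': "bdd_above ((\<lambda>t. L' t * L t) ` {0..})"
    and cond_ii: "bdd_above ((\<lambda>t. integral {0..t}
                     (\<lambda>\<zeta>. 1 / (L \<zeta>)\<^sup>2 - 1 / (L_crit D r)\<^sup>2)) ` {0..})"
    and cond_iii: "(\<lambda>t. L t * neg_part (L'' t)) integrable_on {0..}"
    and nontrivial: "\<exists>x\<in>{0..L 0}. \<psi> x 0 \<noteq> 0"
  shows "\<not> converges_to_zero L \<psi> \<and>
         Liminf at_top (\<lambda>t. ereal (2 / L t *
           integral {0..L t} (\<lambda>x. \<psi> x t * sin (pi * x / L t)))) > 0"
proof -
  obtain u\<^sub>t u\<^sub>y u\<^sub>y\<^sub>y where
    "straightened_problem D r L L' L'' (\<lambda>\<xi> t. \<psi> (\<xi> * L t) t) u\<^sub>t u\<^sub>y u\<^sub>y\<^sub>y"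
    using straightening[OF D_pos L_pos L_deriv L'_deriv L''_cont sol nonneg] by metis
  then interpret straightened_problem D r L L' L'' "\<lambda>\<xi> t. \<psi> (\<xi> * L t) t" u\<^sub>t u\<^sub>y u\<^sub>y\<^sub>y .

  obtain \<Lambda> where \<Lambda>: "L t \<le> \<Lambda>" if "t \<ge> 0" for t
    using cond_i_L unfolding bdd_above_def by auto
  obtain B where B: "L' t * L t \<le> B" if "t \<ge> 0" for t
    using cond_i_L' unfolding bdd_above_def by auto
  let ?g = "\<lambda>s. 1 / (L s)\<^sup>2 - 1 / (L_crit D r)\<^sup>2" and ?h = "\<lambda>s. L s * neg_part (L'' s)"
  obtain C where C: "integral {0..t} ?g \<le> C" if "t \<ge> 0" for t
    using cond_ii unfolding bdd_above_def by auto
  have crit: "D * pi\<^sup>2 * (1 / (L_crit D r)\<^sup>2) = r"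
    unfolding L_crit_def using D_pos r_pos by (simp add: power_mult_distrib)
  have rate: "rate 1 s = D * pi\<^sup>2 * ?g s + 1 / (4 * D) * ?h s" for s
    unfolding rate_def right_diff_distrib crit by (simp add: power_divide)
  have L_nz: "L s \<noteq> 0" if "s \<ge> 0" for s
    using L_pos[OF that] by simp
  have rate_le: "integral {0..t} (rate 1) \<le> D * pi\<^sup>2 * C + 1 / (4 * D) * integral {0..} ?h" if t: "t \<ge> 0" for t
  proof -
    have g_int: "?g integrable_on {0..t}"
      using L_nz by (intro integrable_continuous_real continuous_intros continuous_on_subset[OF L_cont]) auto
    have h_int: "?h integrable_on {0..t}"
      unfolding neg_part_def
      by (intro integrable_continuous_real continuous_intros continuous_on_subset[OF L_cont]
          continuous_on_subset[OF L''_cont]) auto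
    have "integral {0..t} (rate 1) = integral {0..t} (\<lambda>s. D * pi\<^sup>2 * ?g s + 1 / (4 * D) * ?h s)"
      by (intro integral_cong rate)
    also have "\<dots> = integral {0..t} (\<lambda>s. D * pi\<^sup>2 * ?g s) + integral {0..t} (\<lambda>s. 1 / (4 * D) * ?h s)"
      by (intro integral_add integrable_on_mult_right g_int h_int)
    also have "\<dots> = D * pi\<^sup>2 * integral {0..t} ?g + 1 / (4 * D) * integral {0..t} ?h"
      unfolding integral_mult_right ..
    also have "\<dots> \<le> D * pi\<^sup>2 * C + 1 / (4 * D) * integral {0..} ?h"
    proof (intro add_mono mult_left_mono)
      show "integral {0..t} ?h \<le> integral {0..} ?h"
        using L_pos by (intro integral_subset_le h_int cond_iii) (auto simp: neg_part_def less_imp_le)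
    qed (use C[OF t] D_pos in auto)
    finally show ?thesis .
  qed

  obtain x\<^sub>0 where x0: "x\<^sub>0 \<in> {0..L 0}" "\<psi> x\<^sub>0 0 \<noteq> 0"
    using nontrivial by blast
  moreover have "\<psi> 0 0 = 0" "\<psi> (L 0) 0 = 0"
    using sol unfolding classical_solution_def by auto
  ultimately have "x\<^sub>0 \<noteq> 0" "x\<^sub>0 \<noteq> L 0"
    by auto
  then have "x\<^sub>0 / L 0 \<in> {0<..<1}" "\<psi> (x\<^sub>0 / L 0 * L 0) 0 \<noteq> 0"
    using x0 L_pos[of 0] by auto
  then obtain c where c: "c > 0"
    and c_le: "\<And>t. t \<ge> 0 \<Longrightarrow> c \<le> integral {0..1} (\<lambda>\<xi>. \<psi> (\<xi> * L t) t * sin (pi * \<xi>))"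
    using projection_lower_bound[OF \<Lambda> B rate_le] by blast

  have scaled: "2 / L t * integral {0..L t} (\<lambda>x. \<psi> x t * sin (pi * x / L t))
      = 2 * integral {0..1} (\<lambda>\<xi>. \<psi> (\<xi> * L t) t * sin (pi * \<xi>))" if "t \<ge> 0" for t
  proof -
    have "(\<lambda>x. x / L t) ` {0..L t} = {0..1}"
      using L_pos[OF that] image_divide_atLeastAtMost[of "L t" 0 "L t"] by simp
    then show ?thesis
      using integral_stretch_real[of "L t" 0 "L t" "\<lambda>x. \<psi> x t * sin (pi * x / L t)"] L_pos[OF that]
      by (simp add: mult.commute)
  qed
  have "eventually (\<lambda>t. ereal (2 * c) \<le> ereal (2 / L t *
           integral {0..L t} (\<lambda>x. \<psi> x t * sin (pi * x / L t)))) at_top"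
    using eventually_ge_at_top[of 0]
  proof eventually_elim
    case (elim t)
    show ?case
      unfolding scaled[OF elim] using c_le[OF elim] by simp
  qed
  then have liminf_ge: "ereal (2 * c) \<le> Liminf at_top (\<lambda>t. ereal (2 / L t *
           integral {0..L t} (\<lambda>x. \<psi> x t * sin (pi * x / L t))))"
    by (rule Liminf_bounded)
  have "0 < ereal (2 * c)"
    using c by simp
  then have liminf: "0 < Liminf at_top (\<lambda>t. ereal (2 / L t *
           integral {0..L t} (\<lambda>x. \<psi> x t * sin (pi * x / L t))))"
    using liminf_ge by (rule less_le_trans)

  have "\<not> converges_to_zero L \<psi>"
  proof
    assume "converges_to_zero L \<psi>"
    then have "\<forall>\<^sub>F t in at_top. \<forall>\<xi>\<in>{0..1}. dist (\<psi> (\<xi> * L t) t) 0 < c / 2"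
      using c unfolding converges_to_zero_def by (intro uniform_limitD) auto
    then have "\<forall>\<^sub>F t in at_top. t \<ge> 0 \<and> (\<forall>\<xi>\<in>{0..1}. dist (\<psi> (\<xi> * L t) t) 0 < c / 2)"
      using eventually_ge_at_top[of 0] by eventually_elim blast
    then obtain t where t: "t \<ge> 0" "\<And>\<xi>. \<xi> \<in> {0..1} \<Longrightarrow> \<bar>\<psi> (\<xi> * L t) t\<bar> < c / 2"
      using eventually_happens by fastforce
    have "integral {0..1} (\<lambda>\<xi>. \<psi> (\<xi> * L t) t * sin (pi * \<xi>)) \<le> integral {0..1} (\<lambda>_::real. c / 2)"
    proof (rule integral_le)
      show "(\<lambda>\<xi>. \<psi> (\<xi> * L t) t * sin (pi * \<xi>)) integrable_on {0..1}"
        using t by (intro integrable_continuous_real continuous_intros continuous_on_pair_compose[OF u_cont]) auto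
      show "\<psi> (\<xi> * L t) t * sin (pi * \<xi>) \<le> c / 2" if "\<xi> \<in> {0..1}" for \<xi>
      proof -
        have "\<bar>\<psi> (\<xi> * L t) t\<bar> * \<bar>sin (pi * \<xi>)\<bar> \<le> c / 2 * 1"
          using t(2)[OF that] by (intro mult_mono) auto
        then show ?thesis
          by (simp flip: abs_mult)
      qed
    qed auto
    then show False
      using c c_le[OF t(1)] by simp
  qed
  with liminf show ?thesis
    by blast
qed

end
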